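(* Let $k$ be a positive even integer. For each $\varepsilon\in(0,1)$ and each squarefree number $q$ (a positive integer) we have $$\sum_{d\mid q}\frac{d}{\log(dk)^{2-\varepsilon}}\ll\frac{q\log\log(e^eq)}{\log(qk)^{2-\varepsilon}}\ll_\varepsilon\frac{q}{\log(qk)^{2-2\varepsilon}},$$ where the first implied constant is absolute and the second depends only on $\varepsilon$.
   Context: The sum runs over the positive divisors $d$ of $q$. The notation $A\ll B$ means $|A|\le C|B|$ with $C$ an absolute constant, and $A\ll_\varepsilon B$ means the same with $C$ depending only on $\varepsilon$; in particular the constants are independent of $q$ and $k$. *)

theory Defs
  imports Complex_Main "HOL-Computational_Algebra.Squarefree"
begin

end

theory Submission
  imports Defs
begin

text \<open>
  Write \<open>L = ln (q k)\<close> and \<open>\<Lambda> = ln (ln (e\<^sup>e q)) = ln (e + ln q)\<close>, so that \<open>\<Lambda> \<ge> 1\<close>. As \<open>k\<close> is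
  even, \<open>ln (d k) \<ge> ln 2\<close> for every divisor \<open>d\<close>, and no denominator comes close to zero.

  For the first estimate, the divisors are split according to whether \<open>d\<^sup>4 \<le> q\<close>. If \<open>d\<^sup>4 > q\<close>, then
  \<open>L \<le> 4 ln (d k)\<close>, so these divisors contribute at most \<open>16 \<sigma>(q) / L powr (2 - \<epsilon>)\<close>, and the problem
  becomes the bound \<open>\<sigma>(q) \<lless> q \<Lambda>\<close> (\<open>sum_divisors_squarefree_le\<close>). The integers with
  \<open>d\<^sup>4 \<le> q\<close> have sum at most \<open>sqrt q\<close>; the loss from replacing \<open>ln (d k)\<close> by \<open>L\<close> is at most a
  constant times \<open>(ln q)\<^sup>2 + 1\<close>, which the remaining factor \<open>sqrt q\<close> absorbs.

  The bound on \<open>\<sigma>(q) / q = \<Sum>d | d dvd q. 1 / d\<close> follows from an averaging argument. Give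
  the divisor \<open>d\<close> the weight \<open>1 / d\<close>. The weighted mean of \<open>ln d\<close> is at most the sum \<open>S\<close> of
  \<open>ln p / p\<close> over the primes \<open>p\<close> dividing \<open>q\<close>
  (\<open>sum_ln_divisors_over_divisors_le\<close>). By Markov's inequality at least half of the total weight
  therefore lies on integers \<open>d \<le> exp (2 S)\<close>, whose total weight is at most \<open>1 + 2 S\<close> by comparison
  with the harmonic series (\<open>sum_reciprocal_divisors_le\<close>). So the total weight is \<open>O(1 + S)\<close>, and any
  bound \<open>S = O(\<Lambda>)\<close> suffices, whatever its constant. Such a bound holds because the primes up to \<open>n\<close>
  satisfy \<open>\<Sum>p. ln p / p \<le> 2 ln n\<close>, as one sees from \<open>ln (n!) \<le> n ln n\<close>
  (\<open>sum_ln_prime_over_prime_le\<close>), while the prime factors of \<open>q\<close> beyond \<open>e + ln q\<close> contribute at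
  most \<open>ln q / (e + ln q) \<le> 1\<close>.

  The second estimate is \<open>ln x \<le> x powr \<epsilon> / \<epsilon>\<close> at \<open>x = e + ln q \<le> 7 L\<close>.
\<close>

section \<open>Logarithms of integers and their prime factors\<close>

text \<open>There is no exception at \<open>n = 0\<close> because \<open>ln 0 = 0\<close>.\<close>

lemma ln_of_nat_nonneg: "0 \<le> ln (real n)"
  by (cases n) auto

lemma ln_eq_sum_multiplicity_ln_primes:
  fixes n :: nat
  assumes "n > 0"
  shows "ln (real n) = (\<Sum>p\<in>prime_factors n. real (multiplicity p n) * ln (real p))"
proof -
  have "real n = (\<Prod>p\<in>prime_factors n. real p ^ multiplicity p n)"
    by (subst prime_factorization_nat[OF assms]) simp
  then have "ln (real n) = ln (\<Prod>p\<in>prime_factors n. real p ^ multiplicity p n)"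
    by simp
  also have "\<dots> = (\<Sum>p\<in>prime_factors n. ln (real p ^ multiplicity p n))"
    by (rule ln_prod) (auto simp: in_prime_factors_iff)
  also have "\<dots> = (\<Sum>p\<in>prime_factors n. real (multiplicity p n) * ln (real p))"
    by (intro sum.cong refl ln_realpow) 
  finally show ?thesis .
qed

lemma sum_ln_prime_factors_le:
  fixes n :: nat
  assumes "n > 0"
  shows "(\<Sum>p\<in>prime_factors n. ln (real p)) \<le> ln (real n)"
proof -
  have "ln (real p) \<le> real (multiplicity p n) * ln (real p)" if "p \<in> prime_factors n" for p
  proof -
    have "multiplicity p n \<ge> 1"
      using that by (simp add: prime_factors_multiplicity Suc_le_eq)
    moreover have "ln (real p) \<ge> 0"
      by (rule ln_of_nat_nonneg)
    ultimately show ?thesis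
      using mult_right_mono[of 1 "real (multiplicity p n)" "ln (real p)"] by simp
  qed
  then show ?thesis
    unfolding ln_eq_sum_multiplicity_ln_primes[OF assms] by (rule sum_mono)
qed

lemma ln_squarefree_eq_sum_ln_primes:
  fixes n :: nat
  assumes "squarefree n"
  shows "ln (real n) = (\<Sum>p\<in>prime_factors n. ln (real p))"
proof -
  have "n > 0" using assms by (cases n) auto
  moreover have "multiplicity p n = 1" if "p \<in> prime_factors n" for p
    using assms that squarefree_factorial_semiring'[of n] \<open>n > 0\<close> by simp
  ultimately show ?thesis
    by (simp add: ln_eq_sum_multiplicity_ln_primes)
qed

text \<open>Any set of positive integers up to \<open>x\<close> is compared with the whole harmonic sum.\<close>

lemma sum_reciprocals_le_one_plus_ln:
  fixes A :: "nat set" and x :: real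
  assumes A: "\<And>d. d \<in> A \<Longrightarrow> 0 < d \<and> real d \<le> x" and x: "x \<ge> 1"
  shows "(\<Sum>d\<in>A. 1 / real d) \<le> 1 + ln x"
proof -
  have harm: "(\<Sum>d=1..Suc n. 1 / real d) \<le> 1 + ln (real (Suc n))" for n
  proof (induction n)
    case 0
    then show ?case by simp
  next
    case (Suc n)
    have "ln (real (Suc n) / real (Suc (Suc n))) \<le> real (Suc n) / real (Suc (Suc n)) - 1"
      by (rule ln_le_minus_one) simp
    then have "1 / real (Suc (Suc n)) \<le> ln (real (Suc (Suc n))) - ln (real (Suc n))"
      by (simp add: ln_div field_simps)
    with Suc show ?case by simp
  qed
  define N where "N = nat \<lfloor>x\<rfloor>"
  have N: "N \<ge> 1" "real N \<le> x" using x by (auto simp: N_def le_nat_iff)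
  have "A \<subseteq> {1..N}" using A by (force simp: N_def le_nat_iff le_floor_iff)
  then have "(\<Sum>d\<in>A. 1 / real d) \<le> (\<Sum>d=1..N. 1 / real d)"
    by (intro sum_mono2) auto
  also have "\<dots> \<le> 1 + ln (real N)" using harm[of "N - 1"] N by simp
  also have "\<dots> \<le> 1 + ln x" using N by simp
  finally show ?thesis .
qed

text \<open>Keeps \<open>ln (d k)\<close> and \<open>ln (q k)\<close> away from zero when \<open>k\<close> is a positive even number.\<close>

lemma half_le_ln:
  fixes k :: nat
  assumes "k \<ge> 2"
  shows "1/2 \<le> ln (real k)"
proof -
  have "ln (1 / 2 :: real) \<le> 1 / 2 - 1" by (rule ln_le_minus_one) simp
  then have "1/2 \<le> ln (2::real)" by (simp add: ln_div)
  also have "\<dots> \<le> ln (real k)" using assms by simp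
  finally show ?thesis .
qed

section \<open>The sum of ln p / p over primes\<close>

text \<open>
  Sum \<open>ln p\<close> over all pairs of a prime \<open>p\<close> and a multiple \<open>m\<close> of \<open>p\<close> with \<open>m \<le> n\<close>. A fixed \<open>m\<close>
  contributes at most \<open>ln m \<le> ln n\<close>, so the total is at most \<open>n ln n\<close>. A fixed \<open>p\<close> contributes
  \<open>\<lfloor>n / p\<rfloor> ln p\<close>, and rounding down loses at most a factor 2 because \<open>p \<le> n\<close>.
\<close>

lemma sum_ln_prime_over_prime_le:
  fixes n :: nat
  assumes "n > 0"
  shows "(\<Sum>p | prime p \<and> p \<le> n. ln (real p) / real p) \<le> 2 * ln (real n)"
proof -
  let ?P = "{p. prime p \<and> p \<le> n}"
  have [simp]: "finite ?P" by (rule finite_subset[of _ "{..n}"]) auto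
  have half: "real n * (ln (real p) / real p) \<le> 2 * (\<Sum>m | m \<in> {1..n} \<and> p dvd m. ln (real p))"
    if p: "p \<in> ?P" for p
  proof -
    have p0: "p > 0" "p \<le> n" using p by (auto simp: prime_gt_0_nat)
    have "{m. m \<in> {1..n} \<and> p dvd m} = (\<lambda>j. p * j) ` {1..n div p}"
      using p0 by (auto simp: less_eq_div_iff_mult_less_eq mult.commute elim!: dvdE)
    then have card: "card {m. m \<in> {1..n} \<and> p dvd m} = n div p"
      using p0 by (simp add: card_image inj_on_def)
    have "1 \<le> n div p" using p0 by (simp add: less_eq_div_iff_mult_less_eq)
    then have "p * 1 \<le> p * (n div p)" by (rule mult_le_mono2)
    moreover have "n = p * (n div p) + n mod p" by simp
    moreover have "n mod p < p" using p0 by simp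
    ultimately have "n \<le> 2 * (p * (n div p))" by linarith
    then have "real n \<le> 2 * (real p * real (n div p))" by (metis of_nat_le_iff of_nat_mult of_nat_numeral)
    then have "real n / real p \<le> 2 * real (n div p)" using p0 by (simp add: field_simps)
    moreover have "ln (real p) \<ge> 0" using p0 by simp
    ultimately have "real n / real p * ln (real p) \<le> 2 * real (n div p) * ln (real p)"
      by (rule mult_right_mono)
    then show ?thesis using card by simp
  qed
  have "real n * (\<Sum>p\<in>?P. ln (real p) / real p)
      \<le> 2 * (\<Sum>p\<in>?P. \<Sum>m | m \<in> {1..n} \<and> p dvd m. ln (real p))"
    unfolding sum_distrib_left[of _ _ ?P] by (rule sum_mono[OF half])
  also have "(\<Sum>p\<in>?P. \<Sum>m | m \<in> {1..n} \<and> p dvd m. ln (real p))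
      = (\<Sum>m\<in>{1..n}. \<Sum>p | p \<in> ?P \<and> p dvd m. ln (real p))"
    by (rule sum.swap_restrict) auto
  also have "\<dots> \<le> (\<Sum>m\<in>{1..n}. ln (real n))"
  proof (rule sum_mono)
    fix m assume m: "m \<in> {1..n}"
    then have "{p. p \<in> ?P \<and> p dvd m} = prime_factors m"
      by (auto simp: prime_factors_dvd dest: dvd_imp_le)
    then have "(\<Sum>p | p \<in> ?P \<and> p dvd m. ln (real p)) \<le> ln (real m)"
      using sum_ln_prime_factors_le[of m] m by simp
    also have "\<dots> \<le> ln (real n)" using m by simp
    finally show "(\<Sum>p | p \<in> ?P \<and> p dvd m. ln (real p)) \<le> ln (real n)" .
  qed
  also have "\<dots> = real n * ln (real n)" by simp
  finally have "real n * (\<Sum>p\<in>?P. ln (real p) / real p) \<le> real n * (2 * ln (real n))"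
    by simp
  then show ?thesis using assms by simp
qed

text \<open>
  Cut at \<open>x = e + ln q\<close>. Below the cut the bound over all primes gives \<open>2 ln x\<close>. Above it,
  \<open>ln p / p \<le> ln p / x\<close>, and the sum of \<open>ln p\<close> over all prime factors of \<open>q\<close> is at most
  \<open>ln q \<le> x\<close>.
\<close>

lemma sum_ln_prime_over_prime_factors_le:
  fixes q :: nat
  assumes "q > 0"
  shows "(\<Sum>p\<in>prime_factors q. ln (real p) / real p) \<le> 2 * ln (exp 1 + ln (real q)) + 1"
proof -
  define x where "x = exp 1 + ln (real q)"
  define N where "N = nat \<lfloor>x\<rfloor>"
  have lnq: "ln (real q) \<ge> 0" using assms by simp
  have x: "x > 1" using lnq one_less_exp_iff[of "1::real"] unfolding x_def by linarith
  have N: "N > 0" "real N \<le> x" "x < real N + 1" using x by (auto simp: N_def)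
  let ?F = "prime_factors q"
  let ?P = "{p. prime p \<and> p \<le> N}"
  have "finite ?P" by (rule finite_subset[of _ "{..N}"]) auto
  have "(\<Sum>p\<in>?F \<inter> {..N}. ln (real p) / real p) \<le> (\<Sum>p\<in>?P. ln (real p) / real p)"
    using \<open>finite ?P\<close> by (intro sum_mono2) (auto simp: ln_of_nat_nonneg in_prime_factors_imp_prime)
  also have "\<dots> \<le> 2 * ln (real N)" by (rule sum_ln_prime_over_prime_le[OF N(1)])
  also have "\<dots> \<le> 2 * ln x" using N by simp
  finally have small: "(\<Sum>p\<in>?F \<inter> {..N}. ln (real p) / real p) \<le> 2 * ln x" .
  have "(\<Sum>p\<in>?F - {..N}. ln (real p) / real p) \<le> (\<Sum>p\<in>?F - {..N}. ln (real p) / x)"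
  proof (rule sum_mono)
    fix p assume p: "p \<in> ?F - {..N}"
    then have "real p \<ge> real N + 1" by simp
    then have "x \<le> real p" using N(3) by linarith
    then show "ln (real p) / real p \<le> ln (real p) / x"
      using x by (intro divide_left_mono) auto
  qed
  also have "\<dots> \<le> (\<Sum>p\<in>?F. ln (real p) / x)"
    using x by (intro sum_mono2) (auto simp: ln_of_nat_nonneg)
  also have "\<dots> = (\<Sum>p\<in>?F. ln (real p)) / x" by (simp add: sum_divide_distrib)
  also have "\<dots> \<le> ln (real q) / x"
    using sum_ln_prime_factors_le[OF assms] x by (intro divide_right_mono) auto
  also have "\<dots> \<le> 1" using x by (simp add: x_def)
  finally have large: "(\<Sum>p\<in>?F - {..N}. ln (real p) / real p) \<le> 1" .
  have "(\<Sum>p\<in>?F. ln (real p) / real p)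
      = (\<Sum>p\<in>?F \<inter> {..N}. ln (real p) / real p) + (\<Sum>p\<in>?F - {..N}. ln (real p) / real p)"
    by (rule sum.Int_Diff) auto
  with small large show ?thesis by (simp add: x_def)
qed

section \<open>The sum of divisors of a squarefree number\<close>

text \<open>
  Since \<open>d\<close> is squarefree, \<open>ln d\<close> is the sum of \<open>ln p\<close> over the primes \<open>p\<close> dividing \<open>d\<close>. After
  exchanging the summations, the divisors of \<open>q\<close> that are multiples of \<open>p\<close> have the form \<open>p e\<close>
  with \<open>e\<close> again a divisor of \<open>q\<close>, which produces the factor \<open>1 / p\<close>.
\<close>

lemma sum_ln_divisors_over_divisors_le:
  fixes q :: nat
  assumes q: "squarefree q"
  shows "(\<Sum>d | d dvd q. ln (real d) / real d)
      \<le> (\<Sum>p\<in>prime_factors q. ln (real p) / real p) * (\<Sum>d | d dvd q. 1 / real d)"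
proof -
  have q0: "q > 0" using q by (cases q) auto
  let ?D = "{d. d dvd q}" and ?F = "prime_factors q"
  have [simp]: "finite ?D" using q0 by simp
  have "(\<Sum>d\<in>?D. ln (real d) / real d) = (\<Sum>d\<in>?D. \<Sum>p | p \<in> ?F \<and> p dvd d. ln (real p) / real d)"
  proof (rule sum.cong[OF refl])
    fix d assume d: "d \<in> ?D"
    then have "squarefree d" using q squarefree_mono by blast
    moreover have "prime_factors d = {p. p \<in> ?F \<and> p dvd d}"
    proof -
      have "d dvd q" using d by simp
      then have "d \<noteq> 0" using q0 by auto
      then show ?thesis
        using q0 dvd_trans[OF _ \<open>d dvd q\<close>] by (auto simp: prime_factors_dvd)
    qed
    ultimately show "ln (real d) / real d = (\<Sum>p | p \<in> ?F \<and> p dvd d. ln (real p) / real d)"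
      by (simp add: ln_squarefree_eq_sum_ln_primes sum_divide_distrib)
  qed
  also have "\<dots> = (\<Sum>p\<in>?F. \<Sum>d | d \<in> ?D \<and> p dvd d. ln (real p) / real d)"
    by (rule sum.swap_restrict) auto
  also have "\<dots> \<le> (\<Sum>p\<in>?F. ln (real p) / real p * (\<Sum>d\<in>?D. 1 / real d))"
  proof (rule sum_mono)
    fix p assume p: "p \<in> ?F"
    then have p0: "p > 0" by (simp add: prime_gt_0_nat in_prime_factors_imp_prime)
    have "{d. d \<in> ?D \<and> p dvd d} \<subseteq> (\<lambda>e. p * e) ` ?D"
    proof
      fix d assume d: "d \<in> {d. d \<in> ?D \<and> p dvd d}"
      then obtain e where e: "d = p * e" by (auto elim: dvdE)
      with d have "e dvd q" using dvd_mult_right by blast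
      with e show "d \<in> (\<lambda>e. p * e) ` ?D" by blast
    qed
    then have "(\<Sum>d | d \<in> ?D \<and> p dvd d. ln (real p) / real d)
        \<le> (\<Sum>d\<in>(\<lambda>e. p * e) ` ?D. ln (real p) / real d)"
      using p0 by (intro sum_mono2) (auto simp: ln_of_nat_nonneg)
    also have "\<dots> = (\<Sum>e\<in>?D. ln (real p) / real (p * e))"
      using p0 by (subst sum.reindex) (auto simp: inj_on_def)
    also have "\<dots> = ln (real p) / real p * (\<Sum>d\<in>?D. 1 / real d)"
      by (simp add: sum_distrib_left)
    finally show "(\<Sum>d | d \<in> ?D \<and> p dvd d. ln (real p) / real d)
        \<le> ln (real p) / real p * (\<Sum>d\<in>?D. 1 / real d)" .
  qed
  also have "\<dots> = (\<Sum>p\<in>?F. ln (real p) / real p) * (\<Sum>d\<in>?D. 1 / real d)"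
    by (simp add: sum_distrib_right)
  finally show ?thesis .
qed

text \<open>
  Markov's inequality for \<open>ln d\<close> under the weights \<open>1 / d\<close>, whose mean is at most \<open>T\<close>: the divisors
  with \<open>ln d > 2 T\<close> carry at most half of the total weight. A strictly positive upper bound \<open>T\<close>
  stands in for the prime sum itself, which vanishes for \<open>q = 1\<close>.
\<close>

lemma sum_reciprocal_divisors_le:
  fixes q :: nat
  assumes q: "squarefree q" and T: "(\<Sum>p\<in>prime_factors q. ln (real p) / real p) \<le> T" "T > 0"
  shows "(\<Sum>d | d dvd q. 1 / real d) \<le> 2 * (1 + 2 * T)"
proof -
  have q0: "q > 0" using q by (cases q) auto
  let ?D = "{d. d dvd q}" and ?B = "{d. real d \<le> exp (2 * T)}"
  define f where "f = (\<Sum>d\<in>?D. 1 / real d)"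
  have [simp]: "finite ?D" using q0 by simp
  have pos: "d > 0" if "d \<in> ?D" for d using that q0 by (auto intro: dvd_pos_nat)
  have f0: "f \<ge> 0" unfolding f_def by (intro sum_nonneg) auto
  have "2 * T * (\<Sum>d\<in>?D - ?B. 1 / real d) \<le> (\<Sum>d\<in>?D - ?B. ln (real d) / real d)"
    unfolding sum_distrib_left
  proof (rule sum_mono)
    fix d assume d: "d \<in> ?D - ?B"
    then have "2 * T \<le> ln (real d)" using pos[of d] by (subst ln_ge_iff) auto
    then show "2 * T * (1 / real d) \<le> ln (real d) / real d"
      by (simp add: divide_right_mono)
  qed
  also have "\<dots> \<le> (\<Sum>d\<in>?D. ln (real d) / real d)"
    using pos by (intro sum_mono2) (auto simp: ln_of_nat_nonneg)
  also have "\<dots> \<le> T * f"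
    using sum_ln_divisors_over_divisors_le[OF q] mult_right_mono[OF T(1) f0]
    unfolding f_def by linarith
  finally have "T * (2 * (\<Sum>d\<in>?D - ?B. 1 / real d)) \<le> T * f" by (simp add: mult_ac)
  then have "2 * (\<Sum>d\<in>?D - ?B. 1 / real d) \<le> f" using T(2) by simp
  moreover have "(\<Sum>d\<in>?D \<inter> ?B. 1 / real d) \<le> 1 + ln (exp (2 * T))"
    using pos T(2) by (intro sum_reciprocals_le_one_plus_ln) auto
  moreover have "f = (\<Sum>d\<in>?D \<inter> ?B. 1 / real d) + (\<Sum>d\<in>?D - ?B. 1 / real d)"
    unfolding f_def by (rule sum.Int_Diff) auto
  ultimately show ?thesis unfolding f_def[symmetric] by simp
qed

lemma ln_ln_exp_exp_mult:
  fixes q :: nat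
  assumes "q > 0"
  shows "ln (ln (exp (exp 1) * real q)) = ln (exp 1 + ln (real q))"
  using assms by (simp add: ln_mult)

lemma one_le_ln_exp_plus_ln:
  fixes q :: nat
  shows "1 \<le> ln (exp 1 + ln (real q))"
proof -
  have "exp 1 + ln (real q) \<ge> exp 1" using ln_of_nat_nonneg[of q] by simp
  then show ?thesis
    by (smt (verit) exp_gt_zero ln_ge_iff)
qed

lemma sum_divisors_squarefree_le:
  fixes q :: nat
  assumes q: "squarefree q"
  shows "(\<Sum>d | d dvd q. real d) \<le> 14 * real q * ln (exp 1 + ln (real q))"
proof -
  have q0: "q > 0" using q by (cases q) auto
  define \<Lambda> where "\<Lambda> = ln (exp 1 + ln (real q))"
  have \<Lambda>: "\<Lambda> \<ge> 1" unfolding \<Lambda>_def by (rule one_le_ln_exp_plus_ln)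
  have "(\<Sum>p\<in>prime_factors q. ln (real p) / real p) \<le> 3 * \<Lambda>"
    using sum_ln_prime_over_prime_factors_le[OF q0] \<Lambda> unfolding \<Lambda>_def by linarith
  then have "(\<Sum>d | d dvd q. 1 / real d) \<le> 2 * (1 + 2 * (3 * \<Lambda>))"
    using q \<Lambda> by (intro sum_reciprocal_divisors_le) auto
  also have "\<dots> \<le> 14 * \<Lambda>" using \<Lambda> by simp
  finally have rec: "(\<Sum>d | d dvd q. 1 / real d) \<le> 14 * \<Lambda>" .
  have cofactor: "q div (q div d) = d" "q div d dvd q" "real q * (1 / real (q div d)) = real d"
    if d: "d dvd q" for d
  proof -
    obtain e where "q = d * e" using d by auto
    moreover from this have "d > 0" "e > 0" using q0 by auto
    ultimately show "q div (q div d) = d" "q div d dvd q" "real q * (1 / real (q div d)) = real d"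
      by simp_all
  qed
  have "(\<Sum>d | d dvd q. real d) = (\<Sum>d | d dvd q. real q * (1 / real d))"
    by (rule sum.reindex_bij_witness[of _ "\<lambda>d. q div d" "\<lambda>d. q div d"]) (use cofactor in simp_all)
  also have "\<dots> = real q * (\<Sum>d | d dvd q. 1 / real d)" by (simp add: sum_distrib_left)
  also have "\<dots> \<le> real q * (14 * \<Lambda>)" by (intro mult_left_mono rec) auto
  finally show ?thesis by (simp add: \<Lambda>_def mult_ac)
qed

section \<open>The two estimates\<close>

text \<open>
  Replaces the logarithm \<open>a = ln (d k)\<close> of a denominator by \<open>b = ln (q k)\<close> at the cost of
  \<open>c\<^sup>2\<close>, uniformly in the exponent \<open>0 \<le> s \<le> 2\<close>; this is why the first implied constant can be
  independent of \<open>\<epsilon>\<close>.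
\<close>

lemma divide_powr_le_of_le_mult:
  fixes a b c s w :: real
  assumes "0 < a" "b \<le> c * a" "1 \<le> c" "0 < b" "0 \<le> s" "s \<le> 2" "w \<ge> 0"
  shows "w / a powr s \<le> c\<^sup>2 * w / b powr s"
proof -
  have "b powr s \<le> (c * a) powr s" using assms by (intro powr_mono2) auto
  also have "\<dots> = c powr s * a powr s" using assms by (simp add: powr_mult)
  also have "\<dots> \<le> c powr 2 * a powr s" using assms by (intro mult_right_mono powr_mono) auto
  also have "c powr 2 = c\<^sup>2" using assms by simp
  finally have "b powr s \<le> c\<^sup>2 * a powr s" .
  then have "w * b powr s \<le> w * (c\<^sup>2 * a powr s)" using assms by (intro mult_left_mono) auto
  then show ?thesis using assms by (simp add: field_simps)
qed

text \<open>
  With \<open>t = q powr (1/4)\<close>, the divisors \<open>d \<le> t\<close> satisfy \<open>L \<le> 9 t ln (d k)\<close>. There are at most \<open>t\<close>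
  of them, each contributing at most \<open>(9 t)\<^sup>2 t / L powr s\<close>, so they contribute
  at most \<open>81 q / L powr s\<close> in total. The divisors \<open>d > t\<close> contribute at most
  \<open>16 \<sigma>(q) / L powr s \<le> 16 \<cdot> 14 q \<Lambda> / L powr s\<close>; the constant is \<open>81 + 16 \<cdot> 14\<close>.
\<close>

lemma divisor_sum_over_ln_powr_le:
  fixes q k :: nat and s :: real
  assumes q: "squarefree q" and k: "k \<ge> 2" and s: "0 \<le> s" "s \<le> 2"
  shows "(\<Sum>d | d dvd q. real d / ln (real d * real k) powr s)
      \<le> 305 * (real q * ln (exp 1 + ln (real q)) / ln (real q * real k) powr s)"
proof -
  have q0: "q > 0" using q by (cases q) auto
  let ?D = "{d. d dvd q}" and ?B = "{d::nat. d ^ 4 \<le> q}"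
  have [simp]: "finite ?D" using q0 by simp
  have pos: "d > 0" if "d \<in> ?D" for d using that q0 by (auto intro: dvd_pos_nat)
  define L where "L = ln (real q * real k)"
  define \<Lambda> where "\<Lambda> = ln (exp 1 + ln (real q))"
  have \<Lambda>: "\<Lambda> \<ge> 1" unfolding \<Lambda>_def by (rule one_le_ln_exp_plus_ln)
  have L_eq: "L = ln (real q) + ln (real k)" using q0 k by (simp add: L_def ln_mult)
  have lnq: "ln (real q) \<ge> 0" using q0 by simp
  have lnk: "ln (real k) \<ge> 1/2" by (rule half_le_ln[OF k])
  have L0: "L > 0" using L_eq lnq lnk by linarith
  have dk: "ln (real d * real k) = ln (real d) + ln (real k)" "ln (real d) \<ge> 0" if "d > 0" for d
    using that k by (simp_all add: ln_mult)

  define t where "t = real q powr (1/4)"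
  have t4: "t ^ 4 = real q" using q0 by (simp add: t_def powr_power)
  have t1: "t \<ge> 1" using q0 by (simp add: t_def ge_one_powr_ge_zero)
  have "ln (real q) \<le> 4 * t"
    using ln_powr_bound[of "real q" "1/4"] q0 by (simp add: t_def)
  have B_le: "real d \<le> t" if "d \<in> ?B" for d
  proof (rule power_le_imp_le_base)
    have "real (d ^ 4) \<le> real q" using that by (subst of_nat_le_iff) simp
    then show "real d ^ Suc 3 \<le> t ^ Suc 3" using t4 by simp
  qed (use t1 in simp)
  have small_term: "real d / ln (real d * real k) powr s \<le> 81 * t^3 / L powr s"
    if d: "d \<in> ?D \<inter> ?B" for d
  proof -
    have d0: "d > 0" using d pos by blast
    \<comment> \<open>The part \<open>ln q\<close> of \<open>L\<close> costs \<open>8 t\<close>, as \<open>ln q \<le> 4 t\<close> and \<open>ln (d k) \<ge> 1/2\<close>; the part \<open>ln k\<close> costs 1.\<close>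
    have "L \<le> (9 * t) * ln (real d * real k)"
    proof -
      have "ln (real q) * (1/2) \<le> 4 * t * ln (real d * real k)"
        using \<open>ln (real q) \<le> 4 * t\<close> lnq lnk dk[OF d0] by (intro mult_mono) auto
      moreover have "ln (real k) \<le> 1 * ln (real d * real k)" using dk[OF d0] by simp
      moreover have "1 * ln (real d * real k) \<le> t * ln (real d * real k)"
        using t1 dk[OF d0] lnk by (intro mult_right_mono) auto
      ultimately show ?thesis using L_eq by (simp add: algebra_simps)
    qed
    then have "real d / ln (real d * real k) powr s \<le> (9 * t)\<^sup>2 * real d / L powr s"
      using dk[OF d0] lnk t1 L0 s by (intro divide_powr_le_of_le_mult) auto
    also have "\<dots> \<le> (9 * t)\<^sup>2 * t / L powr s"
      using B_le[of d] d by (intro divide_right_mono mult_left_mono) auto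
    also have "(9 * t)\<^sup>2 * t = 81 * t^3" by (simp add: power2_eq_square power3_eq_cube)
    finally show ?thesis .
  qed
  have card_small: "real (card (?D \<inter> ?B)) \<le> t"
  proof -
    have "?D \<inter> ?B \<subseteq> {1..nat \<lfloor>t\<rfloor>}"
    proof
      fix d assume d: "d \<in> ?D \<inter> ?B"
      then have "real d \<le> t" using B_le by blast
      with d show "d \<in> {1..nat \<lfloor>t\<rfloor>}" using pos[of d] by (auto simp: le_nat_iff le_floor_iff)
    qed
    then have "card (?D \<inter> ?B) \<le> nat \<lfloor>t\<rfloor>" using card_mono[of "{1..nat \<lfloor>t\<rfloor>}"] by fastforce
    then show ?thesis using t1 by linarith
  qed
  have "(\<Sum>d\<in>?D \<inter> ?B. real d / ln (real d * real k) powr s) \<le> real (card (?D \<inter> ?B)) * (81 * t^3 / L powr s)"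
    using small_term by (rule sum_bounded_above)
  also have "\<dots> \<le> t * (81 * t^3 / L powr s)"
    using card_small t1 by (intro mult_right_mono) auto
  also have "\<dots> = 81 * (real q / L powr s)"
    by (simp add: t4[symmetric] power4_eq_xxxx power3_eq_cube)
  also have "\<dots> \<le> 81 * (real q * \<Lambda> / L powr s)"
    using \<Lambda> mult_left_mono[of 1 \<Lambda> "real q"] by (intro mult_left_mono divide_right_mono) auto
  finally have small: "(\<Sum>d\<in>?D \<inter> ?B. real d / ln (real d * real k) powr s) \<le> 81 * (real q * \<Lambda> / L powr s)" .

  have large_term: "real d / ln (real d * real k) powr s \<le> 4\<^sup>2 * real d / L powr s"
    if d: "d \<in> ?D - ?B" for d
  proof -
    have d0: "d > 0" using d pos by blast
    have "real q \<le> real d ^ 4" using d by (metis Diff_iff linorder_le_cases mem_Collect_eq of_nat_le_iff of_nat_power)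
    then have "ln (real q) \<le> ln (real d ^ 4)" using q0 d0 by simp
    also have "\<dots> = 4 * ln (real d)" using d0 by (simp add: ln_realpow)
    finally have "L \<le> 4 * ln (real d * real k)" using L_eq dk[OF d0] lnk by simp
    then show ?thesis using dk[OF d0] lnk L0 s by (intro divide_powr_le_of_le_mult) auto
  qed
  have "(\<Sum>d\<in>?D - ?B. real d / ln (real d * real k) powr s) \<le> (\<Sum>d\<in>?D - ?B. 4\<^sup>2 * real d / L powr s)"
    by (rule sum_mono[OF large_term])
  also have "\<dots> \<le> (\<Sum>d\<in>?D. 4\<^sup>2 * real d / L powr s)" by (intro sum_mono2) auto
  also have "\<dots> = 16 * (\<Sum>d\<in>?D. real d) / L powr s"
    by (simp add: sum_divide_distrib sum_distrib_left)
  also have "\<dots> \<le> 16 * (14 * real q * \<Lambda>) / L powr s"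
    using sum_divisors_squarefree_le[OF q] unfolding \<Lambda>_def
    by (intro divide_right_mono mult_left_mono) auto
  finally have large: "(\<Sum>d\<in>?D - ?B. real d / ln (real d * real k) powr s) \<le> 224 * (real q * \<Lambda> / L powr s)"
    by simp
  have "(\<Sum>d\<in>?D. real d / ln (real d * real k) powr s)
      = (\<Sum>d\<in>?D \<inter> ?B. real d / ln (real d * real k) powr s) + (\<Sum>d\<in>?D - ?B. real d / ln (real d * real k) powr s)"
    by (rule sum.Int_Diff) auto
  also have "\<dots> \<le> 81 * (real q * \<Lambda> / L powr s) + 224 * (real q * \<Lambda> / L powr s)"
    by (rule add_mono[OF small large])
  finally show ?thesis unfolding L_def \<Lambda>_def by simp
qed

lemma ln_ln_le_powr_ln:
  fixes q k :: nat and \<epsilon> :: real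
  assumes q: "q > 0" and k: "k \<ge> 2" and \<epsilon>: "\<epsilon> > 0"
  shows "ln (exp 1 + ln (real q)) \<le> 7 powr \<epsilon> / \<epsilon> * ln (real q * real k) powr \<epsilon>"
proof -
  define L where "L = ln (real q * real k)"
  have L_eq: "L = ln (real q) + ln (real k)" using q k by (simp add: L_def ln_mult)
  have lnq: "ln (real q) \<ge> 0" using q by simp
  have lnk: "ln (real k) \<ge> 1/2" by (rule half_le_ln[OF k])
  have L0: "L > 0" using L_eq lnq lnk by linarith
  have e: "exp 1 \<le> (3::real)" by (rule exp_le)
  have x1: "exp 1 + ln (real q) \<ge> 1" using lnq one_less_exp_iff[of "1::real"] by linarith
  \<comment> \<open>From \<open>e \<le> 3 \<le> 6 L\<close> and \<open>ln q \<le> L\<close>.\<close>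
  have "exp 1 + ln (real q) \<le> 7 * L" using e lnq lnk L_eq by linarith
  have "ln (exp 1 + ln (real q)) \<le> (exp 1 + ln (real q)) powr \<epsilon> / \<epsilon>"
    by (rule ln_powr_bound[OF x1 \<epsilon>])
  also have "\<dots> \<le> (7 * L) powr \<epsilon> / \<epsilon>"
    using x1 \<epsilon> \<open>exp 1 + ln (real q) \<le> 7 * L\<close> by (intro divide_right_mono powr_mono2) auto
  also have "\<dots> = 7 powr \<epsilon> / \<epsilon> * L powr \<epsilon>"
    using L0 by (simp add: powr_mult)
  finally show ?thesis by (simp add: L_def)
qed

theorem lemma3p15:
  shows "(\<exists>C::real. C > 0 \<and>
           (\<forall>(\<epsilon>::real) (k::nat) (q::nat).
              0 < \<epsilon> \<and> \<epsilon> < 1 \<and> 0 < k \<and> even k \<and> 0 < q \<and> squarefree q \<longrightarrow>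
              \<bar>\<Sum>d | d dvd q. real d / ln (real d * real k) powr (2 - \<epsilon>)\<bar>
                \<le> C * \<bar>real q * ln (ln (exp (exp 1) * real q)) / ln (real q * real k) powr (2 - \<epsilon>)\<bar>))
       \<and> (\<forall>\<epsilon>::real. 0 < \<epsilon> \<and> \<epsilon> < 1 \<longrightarrow>
           (\<exists>C::real. C > 0 \<and>
             (\<forall>(k::nat) (q::nat).
                0 < k \<and> even k \<and> 0 < q \<and> squarefree q \<longrightarrow>
                \<bar>real q * ln (ln (exp (exp 1) * real q)) / ln (real q * real k) powr (2 - \<epsilon>)\<bar>
                  \<le> C * \<bar>real q / ln (real q * real k) powr (2 - 2 * \<epsilon>)\<bar>)))"
proof (intro conjI allI impI)
  have "\<bar>\<Sum>d | d dvd q. real d / ln (real d * real k) powr (2 - \<epsilon>)\<bar>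
      \<le> 305 * \<bar>real q * ln (ln (exp (exp 1) * real q)) / ln (real q * real k) powr (2 - \<epsilon>)\<bar>"
    if "0 < \<epsilon> \<and> \<epsilon> < 1 \<and> 0 < k \<and> even k \<and> 0 < q \<and> squarefree q"
    for \<epsilon> :: real and k q :: nat
  proof -
    have "k \<ge> 2" using that by (auto elim!: evenE)
    then have "(\<Sum>d | d dvd q. real d / ln (real d * real k) powr (2 - \<epsilon>))
        \<le> 305 * (real q * ln (ln (exp (exp 1) * real q)) / ln (real q * real k) powr (2 - \<epsilon>))"
      using divisor_sum_over_ln_powr_le[of q k "2 - \<epsilon>"] that ln_ln_exp_exp_mult[of q] by simp
    moreover have "(\<Sum>d | d dvd q. real d / ln (real d * real k) powr (2 - \<epsilon>)) \<ge> 0"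
      by (intro sum_nonneg) auto
    ultimately show ?thesis by linarith
  qed
  then show "\<exists>C::real. C > 0 \<and>
      (\<forall>(\<epsilon>::real) (k::nat) (q::nat).
        0 < \<epsilon> \<and> \<epsilon> < 1 \<and> 0 < k \<and> even k \<and> 0 < q \<and> squarefree q \<longrightarrow>
        \<bar>\<Sum>d | d dvd q. real d / ln (real d * real k) powr (2 - \<epsilon>)\<bar>
          \<le> C * \<bar>real q * ln (ln (exp (exp 1) * real q)) / ln (real q * real k) powr (2 - \<epsilon>)\<bar>)"
    by (intro exI[of _ 305] conjI) simp_all
next
  fix \<epsilon> :: real
  assume \<epsilon>: "0 < \<epsilon> \<and> \<epsilon> < 1"
  let ?C = "7 powr \<epsilon> / \<epsilon>"
  have "\<bar>real q * ln (ln (exp (exp 1) * real q)) / ln (real q * real k) powr (2 - \<epsilon>)\<bar>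
      \<le> ?C * \<bar>real q / ln (real q * real k) powr (2 - 2 * \<epsilon>)\<bar>"
    if *: "0 < k \<and> even k \<and> 0 < q \<and> squarefree q" for k q :: nat
  proof -
    define L where "L = ln (real q * real k)"
    define \<Lambda> where "\<Lambda> = ln (exp 1 + ln (real q))"
    have k: "k \<ge> 2" using * by (auto elim!: evenE)
    have \<Lambda>: "\<Lambda> \<ge> 1" unfolding \<Lambda>_def by (rule one_le_ln_exp_plus_ln)
    have "1 * 1 < real q * real k" using * k by (intro mult_le_less_imp_less) auto
    then have L0: "L > 0" unfolding L_def by simp
    have "\<Lambda> \<le> ?C * L powr \<epsilon>"
      unfolding \<Lambda>_def L_def using * k \<epsilon> by (intro ln_ln_le_powr_ln) auto
    then have "real q * \<Lambda> / L powr (2 - \<epsilon>) \<le> real q * (?C * L powr \<epsilon>) / L powr (2 - \<epsilon>)"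
      by (intro divide_right_mono mult_left_mono) auto
    also have "\<dots> = ?C * (real q * (L powr \<epsilon> / L powr (2 - \<epsilon>)))" by simp
    also have "L powr \<epsilon> / L powr (2 - \<epsilon>) = 1 / L powr (2 - 2 * \<epsilon>)"
    proof -
      have "L powr \<epsilon> / L powr (2 - \<epsilon>) = L powr (- (2 - 2 * \<epsilon>))"
        by (simp add: powr_diff[symmetric])
      also have "\<dots> = 1 / L powr (2 - 2 * \<epsilon>)" by (rule powr_minus_divide)
      finally show ?thesis .
    qed
    finally have "real q * \<Lambda> / L powr (2 - \<epsilon>) \<le> ?C * (real q / L powr (2 - 2 * \<epsilon>))"
      by simp
    moreover have "real q * \<Lambda> / L powr (2 - \<epsilon>) \<ge> 0" using \<Lambda> by simp
    ultimately show ?thesis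
      using ln_ln_exp_exp_mult[of q] * unfolding L_def \<Lambda>_def by simp
  qed
  moreover have "?C > 0" using \<epsilon> by simp
  ultimately show "\<exists>C::real. C > 0 \<and>
      (\<forall>(k::nat) (q::nat). 0 < k \<and> even k \<and> 0 < q \<and> squarefree q \<longrightarrow>
        \<bar>real q * ln (ln (exp (exp 1) * real q)) / ln (real q * real k) powr (2 - \<epsilon>)\<bar>
          \<le> C * \<bar>real q / ln (real q * real k) powr (2 - 2 * \<epsilon>)\<bar>)"
    by blast
qed

end
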